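(* There exists $N$ such that for all integers $n\ge N$ the following holds. Let $X=\{1,\dots,n\}$ be the vertex set of the complete graph on $n$ vertices, let $(\omega_0,x_0)\in\mathcal{L}(X)$, let $p^{(k)}=\mathcal{M}_X^k(\delta_{\omega_0}\otimes\delta_{x_0})$ be the distribution after $k$ steps of the vertex lamplighter random walk on $X$ starting from $(\omega_0,x_0)$, and let $\pi$ be the uniform distribution on $\mathcal{L}(X)$. If $0<c<\log n$ and $k=\frac12 n(\log n-c)$ is an integer, then \[ \|p^{(k)}-\pi\|_{TV}\ge 1-20e^{-c}. \]
   Context: Let $\mathcal{L}(X)=\{0,1\}^X\times X$, with the graph structure in which $(\omega,x)$ and $(\theta,y)$ are adjacent iff $x\ne y$ and $\omega(z)=\theta(z)$ for all $z\ne x,y$. The vertex lamplighter random walk is the simple random walk on this ($4(n-1)$-regular) graph, and its Markov operator is $(\mathcal{M}_X\Phi)(\omega,x)=\frac{1}{4(n-1)}\sum_{(\theta,y)}\Phi(\theta,y)$, summed over the neighbours $(\theta,y)$ of $(\omega,x)$, for complex functions $\Phi$ on $\mathcal{L}(X)$. The function $\delta_{\omega_0}\otimes\delta_{x_0}$ is the point mass at $(\omega_0,x_0)$. For probability distributions $p,q$ on a finite set $Y$, $\|p-q\|_{TV}=\max_{A\subseteq Y}|p(A)-q(A)|$. $\log$ is the natural logarithm. *)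

theory Defs
  imports "HOL-Analysis.Analysis"
begin

text \<open>
  A lamp configuration in \<open>{0,1}\<^sup>X\<close> is an extensional function (\<open>undefined\<close> outside \<open>X\<close>),
  so that \<open>lamp_states X\<close> is finite for finite \<open>X\<close> and equality of configurations is
  equality on \<open>X\<close>.
\<close>

definition lamp_states :: "'a set \<Rightarrow> (('a \<Rightarrow> nat) \<times> 'a) set" where
  "lamp_states X = (X \<rightarrow>\<^sub>E {0, 1}) \<times> X"

definition lamp_adj :: "'a set \<Rightarrow> ('a \<Rightarrow> nat) \<times> 'a \<Rightarrow> ('a \<Rightarrow> nat) \<times> 'a \<Rightarrow> bool" where
  "lamp_adj X = (\<lambda>(\<omega>, x) (\<theta>, y).
     (\<omega>, x) \<in> lamp_states X \<and> (\<theta>, y) \<in> lamp_states X \<and>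
     x \<noteq> y \<and> (\<forall>z \<in> X - {x, y}. \<omega> z = \<theta> z))"

text \<open>
  Complex functions on \<open>lamp_states X\<close> are represented by functions on the whole type, of which
  only the values on \<open>lamp_states X\<close> matter. The operator returns a function vanishing
  outside \<open>lamp_states X\<close>.
\<close>

definition lamp_markov ::
    "'a set \<Rightarrow> (('a \<Rightarrow> nat) \<times> 'a \<Rightarrow> complex) \<Rightarrow> ('a \<Rightarrow> nat) \<times> 'a \<Rightarrow> complex" where
  "lamp_markov X \<Phi> = (\<lambda>v. 1 / (4 * (of_nat (card X) - 1)) * (\<Sum>w | lamp_adj X v w. \<Phi> w))"

definition point_mass :: "'b \<Rightarrow> 'b \<Rightarrow> complex" where
  "point_mass a = (\<lambda>v. if v = a then 1 else 0)"

definition uniform_dist :: "'b set \<Rightarrow> 'b \<Rightarrow> complex" where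
  "uniform_dist Y = (\<lambda>v. if v \<in> Y then 1 / of_nat (card Y) else 0)"

text \<open>
  For finite \<open>Y\<close>. Distributions are taken complex-valued since the Markov operator acts on
  complex functions; for real values the norm is the absolute value.
\<close>

definition tv_dist :: "'b set \<Rightarrow> ('b \<Rightarrow> complex) \<Rightarrow> ('b \<Rightarrow> complex) \<Rightarrow> real" where
  "tv_dist Y p q = Max ((\<lambda>A. norm ((\<Sum>v\<in>A. p v) - (\<Sum>v\<in>A. q v))) ` Pow Y)"

end

theory Submission
  imports Defs "HOL-Real_Asymp.Real_Asymp"
begin

text \<open>
  Call a lamp aligned if it is in its initial state, and let \<open>W\<close> be the number of aligned lamps
  minus the number of the others. A step of the walk randomizes the lamps at both endpoints of the
  move, so the Walsh function \<open>\<chi>\<^sub>S\<close> of a set \<open>S\<close> of lamps is mapped by the Markov operator to a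
  multiple of its restriction to the positions outside \<open>S\<close>, which is an eigenfunction with
  eigenvalue \<open>1 - |S| / (n - 1)\<close>. As the operator is self-adjoint, the moments of \<open>W\<close> after
  \<open>k\<close> steps can be read off: its mean is \<open>(n - 1) (1 - 1 / (n - 1))\<^sup>k\<close>, about
  \<open>sqrt (n exp c)\<close>, while under the uniform distribution it is \<open>0\<close>. Under both distributions
  distinct lamps are nonpositively correlated, so the variance of \<open>W\<close> is at most \<open>n\<close>, and
  Chebyshev's inequality at half the mean separates the two distributions.
\<close>

section \<open>Total variation and second moments\<close>

text \<open>Chebyshev's inequality for nonnegative weights. \<open>A\<close> may be any subset of
  the deviation event, so one-sided events can be inserted directly.\<close>

lemma chebyshev_sum:
  fixes p f :: "'b \<Rightarrow> real"
  assumes "finite Y" and p: "\<And>v. v \<in> Y \<Longrightarrow> 0 \<le> p v"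
    and var: "(\<Sum>v\<in>Y. p v * (f v - \<mu>)\<^sup>2) \<le> \<sigma>" and "0 < t"
    and A: "A \<subseteq> Y" "\<And>v. v \<in> A \<Longrightarrow> t \<le> \<bar>f v - \<mu>\<bar>"
  shows "sum p A \<le> \<sigma> / t\<^sup>2"
proof -
  have "t\<^sup>2 * sum p A = (\<Sum>v\<in>A. p v * t\<^sup>2)"
    by (simp add: sum_distrib_right mult.commute)
  also have "\<dots> \<le> (\<Sum>v\<in>A. p v * (f v - \<mu>)\<^sup>2)"
    using A p \<open>0 < t\<close> by (intro sum_mono mult_left_mono) (auto simp: abs_le_square_iff[symmetric])
  also have "\<dots> \<le> (\<Sum>v\<in>Y. p v * (f v - \<mu>)\<^sup>2)"
    using assms(1) A(1) p by (intro sum_mono2) auto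
  finally show ?thesis
    using var \<open>0 < t\<close> by (simp add: field_simps)
qed

text \<open>The event that \<open>f\<close> reaches the midpoint of \<open>\<mu>\<close> and
  \<open>\<nu>\<close> separates \<open>p\<close> from \<open>q\<close>: its complement under
  \<open>p\<close> and the event itself under \<open>q\<close> both require a deviation of half the
  gap. Chebyshev bounds each by four times \<open>\<sigma>\<close> over the squared gap, and the two
  add up to the factor 8.\<close>

lemma tv_dist_lower_bound:
  fixes p q f :: "'b \<Rightarrow> real"
  assumes "finite Y"
    and p: "\<And>v. v \<in> Y \<Longrightarrow> 0 \<le> p v" "sum p Y = 1" "(\<Sum>v\<in>Y. p v * (f v - \<mu>)\<^sup>2) \<le> \<sigma>"
    and q: "\<And>v. v \<in> Y \<Longrightarrow> 0 \<le> q v" "(\<Sum>v\<in>Y. q v * (f v - \<nu>)\<^sup>2) \<le> \<sigma>"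
    and "\<nu> < \<mu>"
  shows "1 - 8 * \<sigma> / (\<mu> - \<nu>)\<^sup>2 \<le> tv_dist Y (\<lambda>v. of_real (p v)) (\<lambda>v. of_real (q v))"
proof -
  define A where "A = {v \<in> Y. (\<mu> + \<nu>) / 2 \<le> f v}"
  define t where "t = (\<mu> - \<nu>) / 2"
  have t: "0 < t" "\<sigma> / t\<^sup>2 = 4 * \<sigma> / (\<mu> - \<nu>)\<^sup>2"
    using \<open>\<nu> < \<mu>\<close> by (auto simp: t_def power_divide)
  have "sum p (Y - A) \<le> \<sigma> / t\<^sup>2"
    using assms(1) p(1,3) t(1)
    by (rule chebyshev_sum) (auto simp: A_def t_def not_le field_simps abs_if)
  moreover have "sum q A \<le> \<sigma> / t\<^sup>2"
    using assms(1) q(1,2) t(1)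
    by (rule chebyshev_sum) (auto simp: A_def t_def field_simps abs_if)
  moreover have "sum p (Y - A) = 1 - sum p A"
    using assms(1) p(2) by (subst sum_diff) (auto simp: A_def)
  ultimately have "1 - 8 * \<sigma> / (\<mu> - \<nu>)\<^sup>2 \<le> sum p A - sum q A"
    unfolding t(2) by linarith
  also have "\<dots> \<le> norm ((\<Sum>v\<in>A. complex_of_real (p v)) - (\<Sum>v\<in>A. of_real (q v)))"
    by (simp only: of_real_sum[symmetric] of_real_diff[symmetric] norm_of_real abs_ge_self)
  also have "\<dots> \<le> tv_dist Y (\<lambda>v. of_real (p v)) (\<lambda>v. of_real (q v))"
    unfolding tv_dist_def using assms(1) by (intro Max_ge imageI) (auto simp: A_def)
  finally show ?thesis .
qed

text \<open>In the second moment of the sum, each diagonal term equals 1 because signs square to 1,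
  and the off-diagonal terms are at most the products of the means. Subtracting the squared mean
  leaves at most one unit per sign.\<close>

lemma variance_signs_le:
  fixes p :: "'b \<Rightarrow> real" and s :: "'a \<Rightarrow> 'b \<Rightarrow> real"
  assumes "finite X" and p: "sum p Y = 1"
    and sign: "\<And>z v. z \<in> X \<Longrightarrow> v \<in> Y \<Longrightarrow> (s z v)\<^sup>2 = 1"
    and mean: "\<And>z. z \<in> X \<Longrightarrow> (\<Sum>v\<in>Y. p v * s z v) = m z"
    and corr: "\<And>z w. z \<in> X \<Longrightarrow> w \<in> X \<Longrightarrow> z \<noteq> w \<Longrightarrow> (\<Sum>v\<in>Y. p v * (s z v * s w v)) \<le> m z * m w"
  shows "(\<Sum>v\<in>Y. p v * ((\<Sum>z\<in>X. s z v) - (\<Sum>z\<in>X. m z))\<^sup>2) \<le> real (card X)"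
proof -
  let ?W = "\<lambda>v. \<Sum>z\<in>X. s z v" and ?\<mu> = "\<Sum>z\<in>X. m z"
  have "(\<Sum>v\<in>Y. p v * ?W v) = (\<Sum>z\<in>X. \<Sum>v\<in>Y. p v * s z v)"
    unfolding sum_distrib_left by (rule sum.swap)
  then have EW: "(\<Sum>v\<in>Y. p v * ?W v) = ?\<mu>"
    using mean by simp
  have "(\<Sum>v\<in>Y. p v * (?W v)\<^sup>2) = (\<Sum>v\<in>Y. \<Sum>z\<in>X. \<Sum>w\<in>X. p v * (s z v * s w v))"
    by (simp add: power2_eq_square sum_product) (simp add: sum_distrib_left)
  also have "\<dots> = (\<Sum>z\<in>X. \<Sum>v\<in>Y. \<Sum>w\<in>X. p v * (s z v * s w v))"
    by (rule sum.swap)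
  also have "\<dots> = (\<Sum>z\<in>X. \<Sum>w\<in>X. \<Sum>v\<in>Y. p v * (s z v * s w v))"
    by (intro sum.cong refl sum.swap)
  \<comment> \<open>On the diagonal the exact value is 1; the surplus \<open>m z * m z\<close> is
    added so that the double sum factors into the square of the total mean.\<close>
  also have "\<dots> \<le> (\<Sum>z\<in>X. \<Sum>w\<in>X. (if z = w then 1 else 0) + m z * m w)"
  proof (intro sum_mono)
    fix z w assume zw: "z \<in> X" "w \<in> X"
    show "(\<Sum>v\<in>Y. p v * (s z v * s w v)) \<le> (if z = w then 1 else 0) + m z * m w"
    proof (cases "z = w")
      case True
      have "(\<Sum>v\<in>Y. p v * (s z v * s z v)) = sum p Y"
        using sign zw by (intro sum.cong) (auto simp: power2_eq_square)
      then show ?thesis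
        using True p by simp
    qed (use corr zw in simp)
  qed
  also have "\<dots> = real (card X) + ?\<mu>\<^sup>2"
    using assms(1) by (simp add: sum.distrib power2_eq_square sum_product)
  finally have EW2: "(\<Sum>v\<in>Y. p v * (?W v)\<^sup>2) \<le> real (card X) + ?\<mu>\<^sup>2" .
  have "(\<Sum>v\<in>Y. p v * (?W v - ?\<mu>)\<^sup>2)
      = (\<Sum>v\<in>Y. p v * (?W v)\<^sup>2 - 2 * ?\<mu> * (p v * ?W v) + ?\<mu>\<^sup>2 * p v)"
    by (intro sum.cong refl) (simp add: power2_eq_square algebra_simps)
  also have "\<dots> = (\<Sum>v\<in>Y. p v * (?W v)\<^sup>2) - 2 * ?\<mu> * (\<Sum>v\<in>Y. p v * ?W v) + ?\<mu>\<^sup>2 * sum p Y"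
    by (simp only: sum.distrib sum_subtractf sum_distrib_left[symmetric])
  finally show ?thesis
    using EW2 unfolding EW p by (simp add: power2_eq_square)
qed

section \<open>The real Markov operator\<close>

text \<open>The real counterpart of \<open>lamp_markov\<close>, on which positivity and inequalities
  can be stated directly. The point mass is real-valued, so its iterates are computed here and
  embedded into the complex numbers at the end.\<close>

definition lamp_avg ::
    "'a set \<Rightarrow> (('a \<Rightarrow> nat) \<times> 'a \<Rightarrow> real) \<Rightarrow> ('a \<Rightarrow> nat) \<times> 'a \<Rightarrow> real" where
  "lamp_avg X f = (\<lambda>v. (\<Sum>w | lamp_adj X v w. f w) / (4 * (real (card X) - 1)))"

lemma finite_lamp_states: "finite X \<Longrightarrow> finite (lamp_states X)"
  by (simp add: lamp_states_def finite_PiE)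

lemma lamp_adj_sym: "lamp_adj X v w \<longleftrightarrow> lamp_adj X w v"
  unfolding lamp_adj_def by (auto split: prod.splits) (metis Diff_iff insertE singletonD insert_iff)+

lemma lamp_adj_states: "lamp_adj X v w \<Longrightarrow> v \<in> lamp_states X \<and> w \<in> lamp_states X"
  by (auto simp: lamp_adj_def)

lemma lamp_markov_of_real:
  "lamp_markov X (\<lambda>v. of_real (f v)) = (\<lambda>v. of_real (lamp_avg X f v))"
  by (simp add: lamp_markov_def lamp_avg_def fun_eq_iff)

lemma lamp_markov_funpow_of_real:
  "(lamp_markov X ^^ k) (\<lambda>v. of_real (f v)) = (\<lambda>v. of_real ((lamp_avg X ^^ k) f v))"
  by (induction k) (simp_all add: lamp_markov_of_real)

text \<open>An index set independent of \<open>v\<close> makes it possible to exchange the order of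
  summation in the proof of self-adjointness.\<close>

lemma lamp_avg_eq_sum_states:
  assumes "finite X"
  shows "lamp_avg X f v
    = (\<Sum>w\<in>lamp_states X. (if lamp_adj X v w then f w else 0)) / (4 * (real (card X) - 1))"
proof -
  have "{w. lamp_adj X v w} = {w \<in> lamp_states X. lamp_adj X v w}"
    using lamp_adj_states by blast
  then show ?thesis
    using finite_lamp_states[OF assms] by (simp add: lamp_avg_def sum.inter_filter)
qed

lemma lamp_avg_cmult: "lamp_avg X (\<lambda>v. c * f v) = (\<lambda>v. c * lamp_avg X f v)"
  by (simp add: lamp_avg_def sum_distrib_left)

lemma lamp_avg_nonneg:
  "(\<And>v. 0 \<le> f v) \<Longrightarrow> 1 \<le> card X \<Longrightarrow> 0 \<le> lamp_avg X f v"
  by (auto simp: lamp_avg_def intro!: divide_nonneg_nonneg sum_nonneg)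

lemma lamp_avg_funpow_nonneg:
  "(\<And>v. 0 \<le> f v) \<Longrightarrow> 1 \<le> card X \<Longrightarrow> 0 \<le> (lamp_avg X ^^ k) f v"
  by (induction k arbitrary: v) (simp_all add: lamp_avg_nonneg)

text \<open>Adjacency is symmetric and the normalizing factor is the same at every state, so the
  kernel is symmetric.\<close>

lemma lamp_avg_self_adjoint:
  assumes "finite X"
  shows "(\<Sum>v\<in>lamp_states X. lamp_avg X f v * g v) = (\<Sum>v\<in>lamp_states X. f v * lamp_avg X g v)"
proof -
  let ?Y = "lamp_states X" and ?d = "4 * (real (card X) - 1)"
  have "(\<Sum>v\<in>?Y. lamp_avg X f v * g v)
      = (\<Sum>v\<in>?Y. \<Sum>w\<in>?Y. (if lamp_adj X v w then f w * g v else 0) / ?d)"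
    unfolding lamp_avg_eq_sum_states[OF assms] sum_divide_distrib sum_distrib_right
    by (intro sum.cong refl) simp
  also have "\<dots> = (\<Sum>w\<in>?Y. \<Sum>v\<in>?Y. (if lamp_adj X v w then f w * g v else 0) / ?d)"
    by (rule sum.swap)
  also have "\<dots> = (\<Sum>v\<in>?Y. f v * lamp_avg X g v)"
    unfolding lamp_avg_eq_sum_states[OF assms] sum_divide_distrib sum_distrib_left
    by (intro sum.cong refl) (simp add: lamp_adj_sym)
  finally show ?thesis .
qed

lemma lamp_avg_funpow_self_adjoint:
  assumes "finite X"
  shows "(\<Sum>v\<in>lamp_states X. (lamp_avg X ^^ k) f v * g v)
    = (\<Sum>v\<in>lamp_states X. f v * (lamp_avg X ^^ k) g v)"
\<comment> \<open>\<open>g\<close> varies because the outermost step on \<open>f\<close> is moved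
  onto \<open>g\<close> before the induction hypothesis is applied.\<close>
proof (induction k arbitrary: g)
  case (Suc k)
  then show ?case
    by (simp only: funpow_Suc_right[of _ "lamp_avg X", THEN fun_cong, of _ g]
        funpow.simps(2)[THEN fun_cong, of _ "lamp_avg X" f] o_apply lamp_avg_self_adjoint[OF assms])
qed simp

text \<open>A neighbour amounts to a free choice of the new position \<open>y\<close> and of the new
  lamp states at \<open>x\<close> and \<open>y\<close>. These data can be recovered from the
  neighbour since \<open>y\<close> differs from \<open>x\<close>.\<close>

lemma sum_lamp_neighbours:
  assumes \<eta>: "\<eta> \<in> X \<rightarrow>\<^sub>E {0, 1}" and "x \<in> X" "finite X"
  shows "(\<Sum>w | lamp_adj X (\<eta>, x) w. f w)
    = (\<Sum>y\<in>X - {x}. \<Sum>a\<in>{0, 1}. \<Sum>b\<in>{0, 1}. f (\<eta>(x := a, y := b), y))"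
proof -
  let ?I = "(X - {x}) \<times> {0, 1} \<times> {0::nat, 1}"
  let ?h = "\<lambda>(y, a, b). (\<eta>(x := a, y := b), y)"
  have inj: "inj_on ?h ?I"
  proof (rule inj_onI)
    fix u v assume uv: "u \<in> ?I" "v \<in> ?I" "?h u = ?h v"
    obtain y a b a' b' where u: "u = (y, a, b)" and v: "v = (y, a', b')" and "y \<noteq> x"
      using uv by (auto simp: case_prod_unfold)
    have eq: "\<eta>(x := a, y := b) = \<eta>(x := a', y := b')"
      using uv(3) by (simp add: u v)
    show "u = v"
      using fun_cong[OF eq, of x] fun_cong[OF eq, of y] \<open>y \<noteq> x\<close> by (simp add: u v)
  qed
  have "{w. lamp_adj X (\<eta>, x) w} = ?h ` ?I"
  proof (intro equalityI subsetI)
    fix w assume "w \<in> {w. lamp_adj X (\<eta>, x) w}"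
    then obtain \<theta> y where w: "w = (\<theta>, y)" and \<theta>: "\<theta> \<in> X \<rightarrow>\<^sub>E {0, 1}" and "y \<in> X" "x \<noteq> y"
      and agree: "\<forall>z\<in>X - {x, y}. \<eta> z = \<theta> z"
      by (cases w) (auto simp: lamp_adj_def lamp_states_def)
    \<comment> \<open>Outside \<open>X\<close> both configurations are \<open>undefined\<close> by
      extensionality, so agreement on \<open>X\<close> gives equality of functions.\<close>
    have "\<theta> = \<eta>(x := \<theta> x, y := \<theta> y)"
    proof
      fix z
      show "\<theta> z = (\<eta>(x := \<theta> x, y := \<theta> y)) z"
        using agree PiE_arb[OF \<eta>, of z] PiE_arb[OF \<theta>, of z] by (cases "z \<in> X") auto
    qed
    then have "w = ?h (y, \<theta> x, \<theta> y)"
      by (simp add: w)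
    moreover have "(y, \<theta> x, \<theta> y) \<in> ?I"
      using PiE_mem[OF \<theta> \<open>x \<in> X\<close>] PiE_mem[OF \<theta> \<open>y \<in> X\<close>] \<open>y \<in> X\<close> \<open>x \<noteq> y\<close> by auto
    ultimately show "w \<in> ?h ` ?I"
      by (rule image_eqI)
  next
    fix w assume "w \<in> ?h ` ?I"
    then obtain y a b where "w = (\<eta>(x := a, y := b), y)" "y \<in> X" "y \<noteq> x" "a \<in> {0, 1}" "b \<in> {0, 1}"
      by auto
    then show "w \<in> {w. lamp_adj X (\<eta>, x) w}"
      using \<eta> \<open>x \<in> X\<close> by (auto simp: lamp_adj_def lamp_states_def PiE_def Pi_def extensional_def)
  qed
  moreover have "sum f (?h ` ?I) = (\<Sum>p\<in>?I. f (?h p))"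
    by (rule sum.reindex[OF inj, unfolded o_def])
  ultimately show ?thesis
    by (simp only: sum.cartesian_product case_prod_unfold fst_conv snd_conv)
qed

section \<open>Walsh functions\<close>

text \<open>A character of the group of lamp configurations, normalized to take the value 1 at
  \<open>\<omega>\<^sub>0\<close>.\<close>

definition walsh :: "('a \<Rightarrow> nat) \<Rightarrow> 'a set \<Rightarrow> ('a \<Rightarrow> nat) \<Rightarrow> real" where
  "walsh \<omega>\<^sub>0 S \<eta> = (\<Prod>z\<in>S. if \<eta> z = \<omega>\<^sub>0 z then 1 else - 1)"

definition walsh_off :: "'a set \<Rightarrow> ('a \<Rightarrow> nat) \<Rightarrow> 'a set \<Rightarrow> ('a \<Rightarrow> nat) \<times> 'a \<Rightarrow> real" where
  "walsh_off X \<omega>\<^sub>0 S = (\<lambda>v. if v \<in> lamp_states X \<and> snd v \<notin> S then walsh \<omega>\<^sub>0 S (fst v) else 0)"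

lemma walsh_start: "walsh \<omega>\<^sub>0 S \<omega>\<^sub>0 = 1"
  by (simp add: walsh_def)

lemma walsh_singleton_sq: "(walsh \<omega>\<^sub>0 {z} \<eta>)\<^sup>2 = 1"
  by (simp add: walsh_def)

lemma walsh_pair: "z \<noteq> w \<Longrightarrow> walsh \<omega>\<^sub>0 {z, w} \<eta> = walsh \<omega>\<^sub>0 {z} \<eta> * walsh \<omega>\<^sub>0 {w} \<eta>"
  by (simp add: walsh_def)

lemma walsh_upd_outside: "z \<notin> S \<Longrightarrow> walsh \<omega>\<^sub>0 S (\<eta>(z := a)) = walsh \<omega>\<^sub>0 S \<eta>"
  unfolding walsh_def by (intro prod.cong) auto

text \<open>Exactly one of the two states of lamp \<open>z\<close> is aligned, so the two terms
  differ only in sign.\<close>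

lemma sum_walsh_upd:
  assumes "finite S" "z \<in> S" "\<omega>\<^sub>0 z \<in> {0, 1}"
  shows "(\<Sum>a\<in>{0, 1}. walsh \<omega>\<^sub>0 S (\<eta>(z := a))) = 0"
proof -
  have "walsh \<omega>\<^sub>0 S (\<eta>(z := a)) = (if a = \<omega>\<^sub>0 z then 1 else - 1) * walsh \<omega>\<^sub>0 (S - {z}) \<eta>" for a
    using assms(1,2) walsh_upd_outside[of z "S - {z}" \<omega>\<^sub>0 \<eta> a]
    by (simp add: walsh_def prod.remove[of S z])
  then show ?thesis
    using assms(3) by auto
qed

lemma sum_walsh_upd2:
  assumes "finite S" "x \<in> S \<Longrightarrow> \<omega>\<^sub>0 x \<in> {0, 1}" "y \<in> S \<Longrightarrow> \<omega>\<^sub>0 y \<in> {0, 1}" "x \<noteq> y"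
  shows "(\<Sum>a\<in>{0, 1}. \<Sum>b\<in>{0, 1}. walsh \<omega>\<^sub>0 S (\<eta>(x := a, y := b)))
    = (if x \<in> S \<or> y \<in> S then 0 else 4 * walsh \<omega>\<^sub>0 S \<eta>)"
proof -
  consider "y \<in> S" | "x \<in> S" | "x \<notin> S" "y \<notin> S"
    by blast
  then show ?thesis
  proof cases
    case 1
    then show ?thesis
      using sum_walsh_upd[of S y \<omega>\<^sub>0] assms(1,3) 1 by simp
  next
    case 2
    \<comment> \<open>The updates commute, which makes the update at \<open>x\<close> the last one,
      as \<open>sum_walsh_upd\<close> needs for the inner sum.\<close>
    have "(\<Sum>a\<in>{0, 1}. \<Sum>b\<in>{0, 1}. walsh \<omega>\<^sub>0 S (\<eta>(x := a, y := b)))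
        = (\<Sum>b\<in>{0, 1}. \<Sum>a\<in>{0, 1}. walsh \<omega>\<^sub>0 S (\<eta>(y := b, x := a)))"
      by (subst sum.swap) (simp only: fun_upd_twist[OF \<open>x \<noteq> y\<close>])
    then show ?thesis
      using 2 sum_walsh_upd[of S x \<omega>\<^sub>0] assms(1,2) by simp
  next
    case 3
    then show ?thesis
      by (simp add: walsh_upd_outside)
  qed
qed

text \<open>Averaging over the lamps at \<open>x\<close> and \<open>y\<close> cancels every
  contribution with \<open>x\<close> or \<open>y\<close> in \<open>S\<close>; for \<open>x\<close>
  outside \<open>S\<close> there remain \<open>card X - 1 - card S\<close> moves. Since targets in
  \<open>S\<close> cancel anyway, the weight \<open>h\<close> is free there: \<open>h = 1\<close>
  gives the full Walsh function and \<open>h = 0\<close> on \<open>S\<close> the restricted one,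
  both with the same image.\<close>

lemma lamp_avg_walsh:
  assumes X: "finite X" "2 \<le> card X" and \<omega>\<^sub>0: "\<omega>\<^sub>0 \<in> X \<rightarrow>\<^sub>E {0, 1}" and S: "S \<subseteq> X"
    and f: "\<And>\<theta> y. (\<theta>, y) \<in> lamp_states X \<Longrightarrow> f (\<theta>, y) = h y * walsh \<omega>\<^sub>0 S \<theta>"
    and h: "\<And>y. y \<notin> S \<Longrightarrow> h y = 1"
  shows "lamp_avg X f = (\<lambda>v. (1 - card S / (real (card X) - 1)) * walsh_off X \<omega>\<^sub>0 S v)"
proof
  fix v :: "('a \<Rightarrow> nat) \<times> 'a"
  obtain \<eta> x where v: "v = (\<eta>, x)"
    by fastforce
  show "lamp_avg X f v = (1 - card S / (real (card X) - 1)) * walsh_off X \<omega>\<^sub>0 S v"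
  proof (cases "v \<in> lamp_states X")
    case False
    then have "{w. lamp_adj X v w} = {}"
      using lamp_adj_states by blast
    then have "lamp_avg X f v = 0"
      by (simp only: lamp_avg_def sum.empty div_0)
    then show ?thesis
      using False by (simp add: walsh_off_def)
  next
    case True
    then have \<eta>: "\<eta> \<in> X \<rightarrow>\<^sub>E {0, 1}" and x: "x \<in> X"
      by (auto simp: v lamp_states_def)
    have "finite S"
      using S X finite_subset by blast
    have 01: "\<omega>\<^sub>0 z \<in> {0, 1}" if "z \<in> X" for z
      using \<omega>\<^sub>0 that by (rule PiE_mem)
    have inner: "(\<Sum>a\<in>{0, 1}. \<Sum>b\<in>{0, 1}. f (\<eta>(x := a, y := b), y))
        = (if y \<notin> S \<and> x \<notin> S then 4 * walsh \<omega>\<^sub>0 S \<eta> else 0)" if y: "y \<in> X - {x}" for y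
    proof -
      have "f (\<eta>(x := a, y := b), y) = h y * walsh \<omega>\<^sub>0 S (\<eta>(x := a, y := b))"
        if "a \<in> {0, 1}" "b \<in> {0, 1}" for a b
        using y x \<eta> that by (intro f) (auto simp: lamp_states_def PiE_def Pi_def extensional_def)
      then have "(\<Sum>a\<in>{0, 1}. \<Sum>b\<in>{0, 1}. f (\<eta>(x := a, y := b), y))
          = h y * (\<Sum>a\<in>{0, 1}. \<Sum>b\<in>{0, 1}. walsh \<omega>\<^sub>0 S (\<eta>(x := a, y := b)))"
        unfolding sum_distrib_left by (intro sum.cong refl)
      also have "\<dots> = h y * (if x \<in> S \<or> y \<in> S then 0 else 4 * walsh \<omega>\<^sub>0 S \<eta>)"
        using \<open>finite S\<close> 01 x y by (subst sum_walsh_upd2) auto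
      finally show ?thesis
        using h by auto
    qed
    have "(\<Sum>w | lamp_adj X v w. f w)
        = (\<Sum>y\<in>X - {x}. if y \<notin> S \<and> x \<notin> S then 4 * walsh \<omega>\<^sub>0 S \<eta> else 0)"
      unfolding v sum_lamp_neighbours[OF \<eta> x X(1)] by (intro sum.cong refl inner)
    also have "\<dots> = (if x \<in> S then 0 else 4 * (real (card X) - 1 - card S) * walsh \<omega>\<^sub>0 S \<eta>)"
    proof (cases "x \<in> S")
      case False
      have "(\<Sum>y\<in>X - {x}. if y \<notin> S \<and> x \<notin> S then 4 * walsh \<omega>\<^sub>0 S \<eta> else 0)
          = (\<Sum>y\<in>(X - {x}) - S. 4 * walsh \<omega>\<^sub>0 S \<eta>)"
        using X False by (intro sum.mono_neutral_cong_right) auto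
      also have "real (card ((X - {x}) - S)) = real (card X) - 1 - card S"
      proof -
        have "card ((X - {x}) - S) = card (X - {x}) - card S"
          using \<open>finite S\<close> S False by (intro card_Diff_subset) auto
        moreover have "card S \<le> card (X - {x})"
          using X S False by (intro card_mono) auto
        moreover have "card (X - {x}) = card X - 1"
          using X x by simp
        ultimately show ?thesis
          using X(2) by (simp add: of_nat_diff)
      qed
      then have "(\<Sum>y\<in>(X - {x}) - S. 4 * walsh \<omega>\<^sub>0 S \<eta>)
          = 4 * (real (card X) - 1 - card S) * walsh \<omega>\<^sub>0 S \<eta>"
        by simp
      finally show ?thesis
        using False by simp
    qed simp
    finally have avg: "lamp_avg X f v = (if x \<in> S then 0
        else 4 * (real (card X) - 1 - card S) * walsh \<omega>\<^sub>0 S \<eta>) / (4 * (real (card X) - 1))"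
      unfolding lamp_avg_def by simp
    show ?thesis
      unfolding avg using True X(2) by (simp add: walsh_off_def v field_simps)
  qed
qed

lemma lamp_avg_walsh_off:
  assumes "finite X" "2 \<le> card X" "\<omega>\<^sub>0 \<in> X \<rightarrow>\<^sub>E {0, 1}" "S \<subseteq> X"
  shows "lamp_avg X (walsh_off X \<omega>\<^sub>0 S)
    = (\<lambda>v. (1 - card S / (real (card X) - 1)) * walsh_off X \<omega>\<^sub>0 S v)"
  by (rule lamp_avg_walsh[OF assms, where h = "\<lambda>y. if y \<in> S then 0 else 1"])
    (auto simp: walsh_off_def)

lemma lamp_avg_funpow_walsh_off:
  assumes "finite X" "2 \<le> card X" "\<omega>\<^sub>0 \<in> X \<rightarrow>\<^sub>E {0, 1}" "S \<subseteq> X"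
  shows "(lamp_avg X ^^ k) (walsh_off X \<omega>\<^sub>0 S)
    = (\<lambda>v. (1 - card S / (real (card X) - 1)) ^ k * walsh_off X \<omega>\<^sub>0 S v)"
  by (induction k) (simp_all add: lamp_avg_cmult lamp_avg_walsh_off[OF assms] mult.left_commute mult.assoc)

lemma lamp_avg_funpow_cmult: "(lamp_avg X ^^ k) (\<lambda>v. c * f v) = (\<lambda>v. c * (lamp_avg X ^^ k) f v)"
  by (induction k) (simp_all add: lamp_avg_cmult)

text \<open>The first step turns the Walsh function into the eigenfunction and already contributes
  one factor of the eigenvalue; the other steps contribute the rest. At \<open>k = 0\<close> the
  restriction to positions outside \<open>S\<close> would not have taken place.\<close>

lemma lamp_avg_funpow_walsh:
  assumes "finite X" "2 \<le> card X" "\<omega>\<^sub>0 \<in> X \<rightarrow>\<^sub>E {0, 1}" "S \<subseteq> X" "0 < k"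
  shows "(lamp_avg X ^^ k) (\<lambda>v. walsh \<omega>\<^sub>0 S (fst v))
    = (\<lambda>v. (1 - card S / (real (card X) - 1)) ^ k * walsh_off X \<omega>\<^sub>0 S v)"
proof -
  obtain j where k: "k = Suc j"
    using \<open>0 < k\<close> gr0_conv_Suc by blast
  have "lamp_avg X (\<lambda>v. walsh \<omega>\<^sub>0 S (fst v))
      = (\<lambda>v. (1 - card S / (real (card X) - 1)) * walsh_off X \<omega>\<^sub>0 S v)"
    by (rule lamp_avg_walsh[OF assms(1-4), where h = "\<lambda>_. 1"]) auto
  then show ?thesis
    unfolding k by (simp add: funpow_Suc_right lamp_avg_funpow_cmult
        lamp_avg_funpow_walsh_off[OF assms(1-4)] mult.assoc del: funpow.simps)
qed

text \<open>
  The sum over all states is invariant under the operator, so it vanishes on an eigenfunction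
  whose eigenvalue is not \<open>1\<close>.
\<close>

lemma sum_walsh_states:
  assumes X: "finite X" "2 \<le> card X" and \<omega>\<^sub>0: "\<omega>\<^sub>0 \<in> X \<rightarrow>\<^sub>E {0, 1}" and S: "S \<subseteq> X" "S \<noteq> {}"
  shows "(\<Sum>v\<in>lamp_states X. walsh \<omega>\<^sub>0 S (fst v)) = 0"
proof -
  let ?Y = "lamp_states X" and ?l = "1 - card S / (real (card X) - 1)"
  have inv: "(\<Sum>v\<in>?Y. lamp_avg X g v) = (\<Sum>v\<in>?Y. g v)" for g
  proof -
    \<comment> \<open>The constant 1 is the Walsh function of the empty set, with eigenvalue 1. By
      self-adjointness the operator then preserves sums over all states.\<close>
    have "lamp_avg X (\<lambda>_. 1) v = 1" if "v \<in> ?Y" for v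
      using lamp_avg_walsh[OF X \<omega>\<^sub>0, where S = "{}" and h = "\<lambda>_. 1" and f = "\<lambda>_. 1"] that
      by (simp add: walsh_def walsh_off_def)
    then show ?thesis
      using lamp_avg_self_adjoint[OF X(1), of g "\<lambda>_. 1"] by simp
  qed
  have off: "lamp_avg X (walsh_off X \<omega>\<^sub>0 S) = (\<lambda>v. ?l * walsh_off X \<omega>\<^sub>0 S v)"
    using X \<omega>\<^sub>0 S(1) by (rule lamp_avg_walsh_off)
  have all: "lamp_avg X (\<lambda>v. walsh \<omega>\<^sub>0 S (fst v)) = (\<lambda>v. ?l * walsh_off X \<omega>\<^sub>0 S v)"
    using lamp_avg_funpow_walsh[OF X \<omega>\<^sub>0 S(1), of 1] by simp
  have "?l * (\<Sum>v\<in>?Y. walsh_off X \<omega>\<^sub>0 S v) = (\<Sum>v\<in>?Y. walsh_off X \<omega>\<^sub>0 S v)"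
    using inv[of "walsh_off X \<omega>\<^sub>0 S"] by (simp add: off sum_distrib_left)
  moreover have "?l \<noteq> 1"
    using X S finite_subset[OF S(1) X(1)] by simp
  ultimately have "(\<Sum>v\<in>?Y. walsh_off X \<omega>\<^sub>0 S v) = 0"
    by simp
  then show ?thesis
    using inv[of "\<lambda>v. walsh \<omega>\<^sub>0 S (fst v)"] by (simp add: all sum_distrib_left[symmetric])
qed

section \<open>The lower bound\<close>

text \<open>The test function is \<open>W\<close>, with mean \<open>\<mu>\<close> after
  \<open>k\<close> steps and mean 0 under the uniform distribution; both variances are at most the
  number of lamps.\<close>

lemma tv_dist_lamp_ge:
  fixes X :: "'a set"
  assumes X: "finite X" "3 \<le> card X" and start: "(\<omega>\<^sub>0, x\<^sub>0) \<in> lamp_states X" and "0 < k"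
    and \<mu>: "\<mu> = (real (card X) - 1) * (1 - 1 / (real (card X) - 1)) ^ k" "0 < \<mu>"
  shows "1 - 8 * real (card X) / \<mu>\<^sup>2
    \<le> tv_dist (lamp_states X) ((lamp_markov X ^^ k) (point_mass (\<omega>\<^sub>0, x\<^sub>0)))
        (uniform_dist (lamp_states X))"
proof -
  let ?Y = "lamp_states X"
  define n where "n = real (card X)"
  define s where "s z v = walsh \<omega>\<^sub>0 {z} (fst v)" for z and v :: "('a \<Rightarrow> nat) \<times> 'a"
  define W where "W v = (\<Sum>z\<in>X. s z v)" for v
  define p where "p = (lamp_avg X ^^ k) (\<lambda>v. if v = (\<omega>\<^sub>0, x\<^sub>0) then 1 else 0)"
  define q where "q v = (if v \<in> ?Y then 1 / real (card ?Y) else 0)" for v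
  \<comment> \<open>The first move randomizes the lamp at the starting position, which therefore has
    mean 0. This is why \<open>\<mu>\<close> counts only \<open>n - 1\<close> lamps.\<close>
  define m where "m z = (if z = x\<^sub>0 then 0 else (1 - 1 / (n - 1)) ^ k)" for z
  have n: "3 \<le> n" and X2: "2 \<le> card X"
    using X by (simp_all add: n_def)
  have finY: "finite ?Y"
    using X(1) by (rule finite_lamp_states)
  have \<omega>\<^sub>0: "\<omega>\<^sub>0 \<in> X \<rightarrow>\<^sub>E {0, 1}" and x\<^sub>0: "x\<^sub>0 \<in> X"
    using start by (auto simp: lamp_states_def)
  have cardY: "card ?Y \<noteq> 0"
    using start finY by auto

  \<comment> \<open>All \<open>k\<close> steps are moved from the point mass onto \<open>f\<close>,
    so an expectation is a value of the iterated test function at the start.\<close>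
  have Ep: "(\<Sum>v\<in>?Y. p v * f v) = (lamp_avg X ^^ k) f (\<omega>\<^sub>0, x\<^sub>0)" for f
  proof -
    have "(\<Sum>v\<in>?Y. p v * f v)
        = (\<Sum>v\<in>?Y. (if v = (\<omega>\<^sub>0, x\<^sub>0) then 1 else 0) * (lamp_avg X ^^ k) f v)"
      unfolding p_def by (rule lamp_avg_funpow_self_adjoint[OF X(1)])
    also have "\<dots> = (lamp_avg X ^^ k) f (\<omega>\<^sub>0, x\<^sub>0)"
      using start finY by (simp add: if_distrib[where f = "\<lambda>t. t * _"] sum.delta' cong: if_cong)
    finally show ?thesis .
  qed
  have Ep_walsh: "(\<Sum>v\<in>?Y. p v * walsh \<omega>\<^sub>0 S (fst v))
      = (if x\<^sub>0 \<in> S then 0 else (1 - card S / (n - 1)) ^ k)" if "S \<subseteq> X" for S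
    unfolding Ep lamp_avg_funpow_walsh[OF X(1) X2 \<omega>\<^sub>0 that \<open>0 < k\<close>]
    using start by (simp add: walsh_off_def walsh_start n_def)
  have p_nonneg: "0 \<le> p v" for v
    unfolding p_def using X by (intro lamp_avg_funpow_nonneg) auto
  \<comment> \<open>Total mass is the expectation of the empty Walsh function.\<close>
  have p_sum: "sum p ?Y = 1"
    using Ep_walsh[of "{}"] by (simp add: walsh_def)
  have p_mean: "(\<Sum>v\<in>?Y. p v * s z v) = m z" if "z \<in> X" for z
    using Ep_walsh[of "{z}"] that by (auto simp: s_def m_def)
  have p_corr: "(\<Sum>v\<in>?Y. p v * (s z v * s w v)) \<le> m z * m w" if "z \<in> X" "w \<in> X" "z \<noteq> w" for z w
  proof -
    have "(\<Sum>v\<in>?Y. p v * (s z v * s w v)) = (if x\<^sub>0 \<in> {z, w} then 0 else (1 - 2 / (n - 1)) ^ k)"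
      using Ep_walsh[of "{z, w}"] that by (simp add: s_def walsh_pair)
    \<comment> \<open>The eigenvalue of a pair is at most the product of those of its two lamps,
      whence nonpositive correlation. At least three lamps are assumed so that the base is
      nonnegative and powers preserve the inequality.\<close>
    moreover have "(1 - 2 / (n - 1)) ^ k \<le> ((1 - 1 / (n - 1)) * (1 - 1 / (n - 1))) ^ k"
    proof (rule power_mono)
      have "1 - 2 * t \<le> (1 - t) * (1 - t)" for t :: real
        by (simp add: algebra_simps)
      from this[of "1 / (n - 1)"] show "1 - 2 / (n - 1) \<le> (1 - 1 / (n - 1)) * (1 - 1 / (n - 1))"
        by simp
      show "0 \<le> 1 - 2 / (n - 1)"
        using n by simp
    qed
    ultimately show ?thesis
      by (auto simp: m_def power_mult_distrib)
  qed
  have "(\<Sum>z\<in>X. m z) = (\<Sum>z\<in>X - {x\<^sub>0}. (1 - 1 / (n - 1)) ^ k)"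
    using X(1) by (intro sum.mono_neutral_cong_right) (auto simp: m_def)
  then have m_sum: "(\<Sum>z\<in>X. m z) = \<mu>"
    using X x\<^sub>0 by (simp add: \<mu>(1) n_def of_nat_diff)
  have p_var: "(\<Sum>v\<in>?Y. p v * (W v - \<mu>)\<^sup>2) \<le> real (card X)"
    unfolding W_def m_sum[symmetric]
    using X(1) p_sum _ p_mean p_corr by (rule variance_signs_le) (auto simp: s_def walsh_singleton_sq)

  have Eq_walsh: "(\<Sum>v\<in>?Y. q v * walsh \<omega>\<^sub>0 S (fst v)) = 0" if "S \<subseteq> X" "S \<noteq> {}" for S
    using sum_walsh_states[OF X(1) X2 \<omega>\<^sub>0 that] by (simp add: q_def sum_divide_distrib[symmetric])
  have q_sum: "sum q ?Y = 1"
    using cardY by (simp add: q_def)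
  have "(\<Sum>v\<in>?Y. q v * ((\<Sum>z\<in>X. s z v) - (\<Sum>z\<in>X. 0))\<^sup>2) \<le> real (card X)"
    using X(1) q_sum
  proof (rule variance_signs_le)
    show "(\<Sum>v\<in>?Y. q v * s z v) = 0" if "z \<in> X" for z
      using Eq_walsh[of "{z}"] that by (simp add: s_def)
    show "(\<Sum>v\<in>?Y. q v * (s z v * s w v)) \<le> 0 * 0" if "z \<in> X" "w \<in> X" "z \<noteq> w" for z w
      using Eq_walsh[of "{z, w}"] that by (simp add: s_def walsh_pair)
  qed (auto simp: s_def walsh_singleton_sq)
  then have q_var: "(\<Sum>v\<in>?Y. q v * (W v - 0)\<^sup>2) \<le> real (card X)"
    by (simp add: W_def)

  have "(lamp_markov X ^^ k) (point_mass (\<omega>\<^sub>0, x\<^sub>0)) = (\<lambda>v. of_real (p v))"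
  proof -
    have "point_mass (\<omega>\<^sub>0, x\<^sub>0) = (\<lambda>v. of_real (if v = (\<omega>\<^sub>0, x\<^sub>0) then 1 else 0))"
      by (auto simp: point_mass_def)
    then show ?thesis
      unfolding p_def by (simp only: lamp_markov_funpow_of_real)
  qed
  moreover have "uniform_dist ?Y = (\<lambda>v. of_real (q v))"
    by (auto simp: uniform_dist_def q_def)
  moreover have "1 - 8 * real (card X) / (\<mu> - 0)\<^sup>2
      \<le> tv_dist ?Y (\<lambda>v. of_real (p v)) (\<lambda>v. of_real (q v))"
    using finY p_nonneg p_sum p_var _ q_var \<mu>(2)
    by (rule tv_dist_lower_bound) (simp_all add: q_def)
  ultimately show ?thesis
    by simp
qed

text \<open>
  From \<open>1 - 1 / (n - 1) = 1 / (1 + 1 / (n - 2)) \<ge> exp (- 1 / (n - 2))\<close>; replacing \<open>n - 2\<close>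
  by \<open>n\<close> in the exponent costs a factor \<open>exp (- ln n / (n - 2))\<close>, which is the error term.
\<close>

lemma mean_lower_bound:
  fixes n c :: real
  assumes n: "3 \<le> n" and c: "0 < c" "c < ln n" and k: "real k = 1 / 2 * n * (ln n - c)"
  shows "(n - 1) * (1 - 1 / (n - 1)) ^ k
    \<ge> (n - 1) * exp (- (ln n / (n - 2))) * exp (- (ln n - c) / 2)"
proof -
  have "1 - 1 / (n - 1) = inverse (1 + 1 / (n - 2))"
    using n by (simp add: field_simps)
  also have "\<dots> \<ge> inverse (exp (1 / (n - 2)))"
    using n by (intro le_imp_inverse_le exp_ge_add_one_self) (auto intro: add_pos_nonneg)
  finally have "exp (- (1 / (n - 2))) \<le> 1 - 1 / (n - 1)"
    by (simp add: exp_minus)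
  then have "exp (- (1 / (n - 2))) ^ k \<le> (1 - 1 / (n - 1)) ^ k"
    by (intro power_mono) auto
  moreover have "exp (- (1 / (n - 2))) ^ k = exp (- (real k / (n - 2)))"
    by (simp add: exp_of_nat_mult[symmetric])
  \<comment> \<open>This uses \<open>n / (2 * (n - 2)) = 1 / 2 + 1 / (n - 2)\<close>; the next
    estimate drops \<open>c\<close> from the second summand only.\<close>
  moreover have "real k / (n - 2) = (ln n - c) / 2 + (ln n - c) / (n - 2)"
    unfolding k using n by (simp add: field_simps)
  then have "exp (- (ln n / (n - 2)) + - (ln n - c) / 2) \<le> exp (- (real k / (n - 2)))"
    using n c divide_right_mono[of "ln n - c" "ln n" "n - 2"] by (simp add: diff_divide_distrib)
  ultimately have "exp (- (ln n / (n - 2))) * exp (- (ln n - c) / 2) \<le> (1 - 1 / (n - 1)) ^ k"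
    unfolding exp_add by linarith
  then show ?thesis
    using n mult_left_mono[of _ _ "n - 1"] by (simp only: mult.assoc)
qed

theorem proposition4p2:
  shows "\<exists>N::nat. \<forall>n\<ge>N. \<forall>(\<omega>\<^sub>0 :: nat \<Rightarrow> nat) (x\<^sub>0 :: nat) (c :: real) (k :: nat).
    (\<omega>\<^sub>0, x\<^sub>0) \<in> lamp_states {1..n} \<longrightarrow>
    0 < c \<longrightarrow> c < ln (real n) \<longrightarrow>
    real k = 1 / 2 * real n * (ln (real n) - c) \<longrightarrow>
    tv_dist (lamp_states {1..n})
      ((lamp_markov {1..n} ^^ k) (point_mass (\<omega>\<^sub>0, x\<^sub>0)))
      (uniform_dist (lamp_states {1..n}))
    \<ge> 1 - 20 * exp (- c)"
proof -
  have "((\<lambda>n. (real n - 1) * exp (- (ln (real n) / (real n - 2))) / real n) \<longlongrightarrow> 1) sequentially"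
    by real_asymp
  \<comment> \<open>Any constant below the limit 1 whose square is at least \<open>8 / 20\<close>
    would serve; \<open>7 / 10\<close> has square \<open>49 / 100\<close>.\<close>
  then have "\<forall>\<^sub>F n in sequentially. 7 / 10 < (real n - 1) * exp (- (ln (real n) / (real n - 2))) / real n"
    by (rule order_tendstoD) simp
  then obtain N where N: "\<And>n. N \<le> n \<Longrightarrow>
      7 / 10 < (real n - 1) * exp (- (ln (real n) / (real n - 2))) / real n"
    unfolding eventually_sequentially by blast
  show ?thesis
  proof (intro exI[of _ "max N 3"] allI impI)
    fix n k :: nat and \<omega>\<^sub>0 :: "nat \<Rightarrow> nat" and x\<^sub>0 :: nat and c :: real
    assume n: "max N 3 \<le> n" and start: "(\<omega>\<^sub>0, x\<^sub>0) \<in> lamp_states {1..n}"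
      and c: "0 < c" "c < ln (real n)" and k: "real k = 1 / 2 * real n * (ln (real n) - c)"
    define \<mu> where "\<mu> = (real n - 1) * (1 - 1 / (real n - 1)) ^ k"
    have n3: "3 \<le> real n"
      using n by simp
    \<comment> \<open>The strict bound \<open>c < ln n\<close> excludes
      \<open>k = 0\<close>.\<close>
    have "0 < real k"
      unfolding k using n3 c by simp
    have "7 / 10 * real n * exp (- (ln (real n) - c) / 2)
        \<le> (real n - 1) * exp (- (ln (real n) / (real n - 2))) * exp (- (ln (real n) - c) / 2)"
      using N[of n] n n3 by (intro mult_right_mono) (auto simp: field_simps)
    also have "\<dots> \<le> \<mu>"
      unfolding \<mu>_def using n3 c k by (rule mean_lower_bound)
    finally have \<mu>: "7 / 10 * real n * exp (- (ln (real n) - c) / 2) \<le> \<mu>" .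
    have "(7 / 10 * real n * exp (- (ln (real n) - c) / 2))\<^sup>2
        = 49 / 100 * (real n)\<^sup>2 * exp (c - ln (real n))"
      by (simp add: power_mult_distrib power2_eq_square flip: exp_add)
    also have "\<dots> = 49 / 100 * real n * exp c"
      using n3 by (simp add: exp_diff power2_eq_square)
    finally have "49 / 100 * real n * exp c \<le> \<mu>\<^sup>2"
      using \<mu> n3 power_mono[OF \<mu>, of 2] by simp
    \<comment> \<open>Nonnegativity allows \<open>49 / 100\<close> to be lowered to
      \<open>2 / 5\<close>, the ratio of the Chebyshev factor 8 to the target 20.\<close>
    moreover have "0 \<le> real n * exp c"
      by simp
    ultimately have "2 * (real n * exp c) \<le> 5 * \<mu>\<^sup>2"
      by linarith
    moreover have "0 < \<mu>"
      using n3 by (intro less_le_trans[OF _ \<mu>]) simp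
    ultimately have "8 * real n / \<mu>\<^sup>2 \<le> 20 * exp (- c)"
      using n3 by (simp add: exp_minus field_simps)
    moreover have "1 - 8 * real (card {1..n}) / \<mu>\<^sup>2
        \<le> tv_dist (lamp_states {1..n}) ((lamp_markov {1..n} ^^ k) (point_mass (\<omega>\<^sub>0, x\<^sub>0)))
            (uniform_dist (lamp_states {1..n}))"
      using n start \<open>0 < real k\<close> \<open>0 < \<mu>\<close> by (intro tv_dist_lamp_ge) (auto simp: \<mu>_def)
    ultimately show "1 - 20 * exp (- c)
        \<le> tv_dist (lamp_states {1..n}) ((lamp_markov {1..n} ^^ k) (point_mass (\<omega>\<^sub>0, x\<^sub>0)))
            (uniform_dist (lamp_states {1..n}))"
      by simp
  qed
qed

end
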